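(* Let $N$ be a finite set of positive integers and let $\sigma\in AMT(N)$ be an antimonotonic function with $sp(\sigma)=N$. Then the set of nonempty intervals of the form $$\Big[\bigvee\{\kappa_S \mid S\in\sigma\},\ \times\{\kappa_S\mid S\in\sigma\}\Big],$$ where $\{\kappa_S\mid S\in\sigma\}$ ranges over all families of antimonotonic functions satisfying $\kappa_S\in\Upsilon_S$ for all $S\in\sigma$, forms a partition of $\Upsilon_N$.
   Context: For a finite set $N$ of positive integers, an antimonotonic function on $2^N$ is a boolean function on $2^N$, identified with the set $\alpha$ of subsets of $N$ on which it is true, such that no element of $\alpha$ is a proper subset of another element of $\alpha$. $AMT(N)$ is the set of all of them (both $\emptyset$ and $\{\emptyset\}$ belong to it). Order: $\alpha\le\beta$ iff every $A\in\alpha$ is contained in some $B\in\beta$. The interval $[\alpha,\beta]$ is $\{\kappa\in AMT(N): \alpha\le\kappa\le\beta\}$ (empty if $\alpha\not\le\beta$). For a family $\mathcal{S}$ of sets, $\sup(\mathcal{S})$ is the set of inclusion-maximal members of $\mathcal{S}$. The span is $sp(\alpha)=\bigcup_{A\in\alpha}A$. Join: $\alpha\vee\beta=\sup(\alpha\cup\beta)$. External product: $\alpha\times\beta=\sup\{(A\setminus sp(\beta))\cup(B\setminus sp(\alpha))\cup(A\cap B)\mid A\in\alpha,\,B\in\beta\}$; for $\alpha,\beta\neq\emptyset$ this is the largest $\kappa\in AMT(N)$ with $sp(\kappa)=sp(\alpha)\cup sp(\beta)$, $\sup\{K\cap sp(\alpha)\mid K\in\kappa\}\le\alpha$ and $\sup\{K\cap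 sp(\beta)\mid K\in\kappa\}\le\beta$. Both operations are associative and commutative; $\bigvee\{\alpha_1,\dots,\alpha_k\}=\alpha_1\vee\dots\vee\alpha_k$ and $\times\{\alpha_1,\dots,\alpha_k\}=\alpha_1\times\dots\times\alpha_k$ (indexed families). By convention both operations applied to an empty family give $\{\emptyset\}$. For a finite set $M$ of positive integers, $\Upsilon_M=[\alpha_M,\omega_M]$ with $\alpha_M=\bigvee\{\{\{x\}\}\mid x\in M\}$ and $\omega_M=\{M\}$; so $\Upsilon_\emptyset=\{\{\emptyset\}\}$, and for $M\ne\emptyset$, $\alpha_M=\{\{x\}\mid x\in M\}$ and $\Upsilon_M$ is the set of antimonotonic functions with span $M$. *)

theory Defs
  imports Main "HOL-Library.Disjoint_Sets"
begin

text \<open>A boolean function on \<open>2\<^sup>N\<close> is represented by the set of subsets of \<open>N\<close> on which it is true.\<close>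

definition AMT :: "'a set \<Rightarrow> 'a set set set" where
  "AMT N = {\<alpha>. \<alpha> \<subseteq> Pow N \<and> (\<forall>A\<in>\<alpha>. \<forall>B\<in>\<alpha>. \<not> A \<subset> B)}"

definition amt_le :: "'a set set \<Rightarrow> 'a set set \<Rightarrow> bool" (infix "\<preceq>" 50) where
  "\<alpha> \<preceq> \<beta> \<longleftrightarrow> (\<forall>A\<in>\<alpha>. \<exists>B\<in>\<beta>. A \<subseteq> B)"

definition amt_interval :: "'a set \<Rightarrow> 'a set set \<Rightarrow> 'a set set \<Rightarrow> 'a set set set" where
  "amt_interval N \<alpha> \<beta> = {\<kappa> \<in> AMT N. \<alpha> \<preceq> \<kappa> \<and> \<kappa> \<preceq> \<beta>}"

definition max_sets :: "'a set set \<Rightarrow> 'a set set" where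
  "max_sets \<S> = {A \<in> \<S>. \<forall>B\<in>\<S>. \<not> A \<subset> B}"

definition sp :: "'a set set \<Rightarrow> 'a set" where
  "sp \<alpha> = (\<Union>A\<in>\<alpha>. A)"

definition amt_join :: "'a set set \<Rightarrow> 'a set set \<Rightarrow> 'a set set" (infixl "\<squnion>" 65) where
  "\<alpha> \<squnion> \<beta> = max_sets (\<alpha> \<union> \<beta>)"

definition ext_prod :: "'a set set \<Rightarrow> 'a set set \<Rightarrow> 'a set set" (infixl "\<boxtimes>" 70) where
  "\<alpha> \<boxtimes> \<beta> = max_sets {(A - sp \<beta>) \<union> (B - sp \<alpha>) \<union> (A \<inter> B) | A B. A \<in> \<alpha> \<and> B \<in> \<beta>}"

lemma max_sets_AMT: "\<alpha> \<in> AMT N \<Longrightarrow> max_sets \<alpha> = \<alpha>"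
  by (auto simp: max_sets_def AMT_def)

lemma amt_join_neutral: "\<alpha> \<in> AMT N \<Longrightarrow> \<alpha> \<squnion> {} = \<alpha>"
  by (simp add: amt_join_def max_sets_AMT)

lemma ext_prod_neutral: "\<alpha> \<in> AMT N \<Longrightarrow> \<alpha> \<boxtimes> {{}} = \<alpha>"
  by (simp add: ext_prod_def sp_def max_sets_AMT)

text \<open>
  Iterated operations over a finite indexed family. The starting values of the folds are the
  neutral elements established above. The empty join is \<open>{\<emptyset>}\<close> by convention; this is not the
  neutral element of the join, since \<open>\<emptyset>\<close> lies strictly below \<open>{\<emptyset>}\<close>.
\<close>

definition amt_Join :: "('i \<Rightarrow> 'a set set) \<Rightarrow> 'i set \<Rightarrow> 'a set set" where
  "amt_Join \<kappa> I = (if I = {} then {{}} else Finite_Set.fold (\<lambda>i \<beta>. \<kappa> i \<squnion> \<beta>) {} I)"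

definition ext_Prod :: "('i \<Rightarrow> 'a set set) \<Rightarrow> 'i set \<Rightarrow> 'a set set" where
  "ext_Prod \<kappa> I = Finite_Set.fold (\<lambda>i \<beta>. \<kappa> i \<boxtimes> \<beta>) {{}} I"

definition amt_bot :: "'a set \<Rightarrow> 'a set set" where
  "amt_bot M = amt_Join (\<lambda>x. {{x}}) M"

definition amt_top :: "'a set \<Rightarrow> 'a set set" where
  "amt_top M = {M}"

definition Upsilon :: "'a set \<Rightarrow> 'a set set set" where
  "Upsilon M = amt_interval M (amt_bot M) (amt_top M)"

text \<open>The ambient set of the interval defining \<open>\<Upsilon>\<^sub>M\<close> does not matter, as long as it contains \<open>M\<close>.\<close>

lemma Upsilon_ambient:
  assumes "M \<subseteq> N"
  shows "Upsilon M = amt_interval N (amt_bot M) (amt_top M)"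
proof -
  have "\<kappa> \<in> AMT M \<longleftrightarrow> \<kappa> \<in> AMT N" if "\<kappa> \<preceq> amt_top M" for \<kappa>
  proof -
    have "\<kappa> \<subseteq> Pow M"
      using that by (auto simp: amt_le_def amt_top_def)
    moreover have "\<kappa> \<subseteq> Pow N"
      using calculation assms by (meson Pow_mono order_trans)
    ultimately show ?thesis
      by (simp add: AMT_def)
  qed
  then show ?thesis
    unfolding Upsilon_def amt_interval_def by (intro Collect_cong) blast
qed

end

theory Submission imports Defs begin

text \<open>
  An antimonotonic function \<open>\<chi>\<close> is the same thing as the down-closed family generated by it,
  written \<open>down \<chi>\<close> below, and under this correspondence the order becomes inclusion. The join
  becomes union, and the external product becomes gluing: a set belongs to the product of the
  \<open>\<kappa> S\<close> as soon as, for each \<open>S\<close>, the part of it lying in \<open>S\<close> belongs to \<open>\<kappa> S\<close>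
  (\<open>amt_Join_eq\<close>, \<open>ext_Prod_eq\<close>).

  Consequently \<open>\<Or>\<kappa> S \<preceq> \<chi>\<close> says that \<open>\<chi>\<close> contains each \<open>\<kappa> S\<close>, and \<open>\<chi> \<preceq> \<times>\<kappa> S\<close> says that
  the part of \<open>\<chi>\<close> inside \<open>S\<close> is contained in \<open>\<kappa> S\<close>. Both together say that \<open>\<kappa> S\<close>
  is exactly the trace of \<open>\<chi>\<close> on \<open>S\<close>, for each \<open>S \<in> \<sigma>\<close> (\<open>interval_eq_fibre\<close>). The intervals
  are therefore the fibres of the map that sends \<open>\<chi>\<close> to its traces on the members of \<open>\<sigma>\<close>, and
  the nonempty fibres of a map partition its domain. Traces of elements of \<open>\<Upsilon>\<^sub>N\<close> on \<open>S\<close> do lie in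
  \<open>\<Upsilon>\<^sub>S\<close> (\<open>trace_Upsilon\<close>), so no fibre is missed.
\<close>

section \<open>Generated down-sets\<close>

definition down :: "'a set set \<Rightarrow> 'a set set" where
  "down F = {X. \<exists>B\<in>F. X \<subseteq> B}"

lemma down_subset_closed: "X \<in> down F \<Longrightarrow> Y \<subseteq> X \<Longrightarrow> Y \<in> down F"
  by (auto simp: down_def)

lemma amt_le_iff_down: "\<alpha> \<preceq> \<beta> \<longleftrightarrow> down \<alpha> \<subseteq> down \<beta>"
proof
  assume le: "\<alpha> \<preceq> \<beta>"
  show "down \<alpha> \<subseteq> down \<beta>"
  proof
    fix X assume "X \<in> down \<alpha>"
    then obtain A where "A \<in> \<alpha>" "X \<subseteq> A"
      unfolding down_def by blast
    moreover obtain B where "B \<in> \<beta>" "A \<subseteq> B"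
      using le \<open>A \<in> \<alpha>\<close> unfolding amt_le_def by blast
    ultimately have "B \<in> \<beta>" "X \<subseteq> B"
      by simp_all
    then show "X \<in> down \<beta>"
      unfolding down_def by blast
  qed
next
  assume sub: "down \<alpha> \<subseteq> down \<beta>"
  have "A \<in> down \<beta>" if "A \<in> \<alpha>" for A
    using sub that unfolding down_def by blast
  then show "\<alpha> \<preceq> \<beta>"
    by (simp add: amt_le_def down_def)
qed

lemma empty_mem_down_iff: "{} \<in> down F \<longleftrightarrow> F \<noteq> {}"
  by (auto simp: down_def)

lemma singleton_mem_down_iff: "{x} \<in> down F \<longleftrightarrow> x \<in> sp F"
  by (auto simp: down_def sp_def)

lemma down_subset_Pow_sp: "down F \<subseteq> Pow (sp F)"
  by (auto simp: down_def sp_def)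

lemma down_Un: "down (F \<union> G) = down F \<union> down G"
  by (auto simp: down_def)

lemma down_UN: "down (\<Union>i\<in>I. F i) = (\<Union>i\<in>I. down (F i))"
  by (auto simp: down_def)

lemma max_sets_down: "max_sets (down F) = max_sets F"
proof -
  have "A \<in> max_sets (down F) \<longleftrightarrow> A \<in> max_sets F" for A
  proof
    assume A: "A \<in> max_sets (down F)"
    then obtain B where B: "B \<in> F" "A \<subseteq> B"
      by (auto simp: max_sets_def down_def)
    have sub: "C \<in> down F" if "C \<in> F" for C
      using that by (auto simp: down_def)
    with A B have "A = B"
      by (auto simp: max_sets_def)
    with A B sub show "A \<in> max_sets F"
      by (auto simp: max_sets_def)
  next
    assume "A \<in> max_sets F"
    then have A: "A \<in> F" "\<And>B. B \<in> F \<Longrightarrow> \<not> A \<subset> B"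
      by (auto simp: max_sets_def)
    have "\<not> A \<subset> C" if C: "C \<in> down F" for C
    proof -
      obtain B where "B \<in> F" "C \<subseteq> B"
        using C by (auto simp: down_def)
      with A(2) show ?thesis
        by (meson psubset_subset_trans)
    qed
    with A(1) show "A \<in> max_sets (down F)"
      by (auto simp: max_sets_def down_def)
  qed
  then show ?thesis
    by blast
qed

lemma down_max_sets:
  assumes "finite F"
  shows "down (max_sets F) = down F"
proof
  show "down (max_sets F) \<subseteq> down F"
    by (auto simp: max_sets_def down_def)
  show "down F \<subseteq> down (max_sets F)"
  proof
    fix X assume "X \<in> down F"
    then obtain B where B: "B \<in> F" "X \<subseteq> B"
      by (auto simp: down_def)
    obtain M where "M \<in> F" "B \<subseteq> M" "\<forall>C\<in>F. M \<subseteq> C \<longrightarrow> M = C"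
      using finite_has_maximal2[OF assms B(1)] by metis
    then have "M \<in> max_sets F" "X \<subseteq> M"
      using B(2) by (auto simp: max_sets_def)
    then show "X \<in> down (max_sets F)"
      by (auto simp: down_def)
  qed
qed

lemma down_max_sets_closed:
  assumes "finite F" "\<And>X Y. X \<in> F \<Longrightarrow> Y \<subseteq> X \<Longrightarrow> Y \<in> F"
  shows "down (max_sets F) = F"
proof -
  have "down F = F"
    using assms(2) by (auto simp: down_def)
  then show ?thesis
    by (simp add: down_max_sets[OF assms(1)])
qed

lemma max_sets_in_AMT: "F \<subseteq> Pow N \<Longrightarrow> max_sets F \<in> AMT N"
  by (auto simp: max_sets_def AMT_def)

lemma max_sets_down_AMT: "\<alpha> \<in> AMT N \<Longrightarrow> max_sets (down \<alpha>) = \<alpha>"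
  by (simp add: max_sets_down max_sets_AMT)

lemma finite_AMT: "finite N \<Longrightarrow> \<alpha> \<in> AMT N \<Longrightarrow> finite \<alpha>"
  by (auto simp: AMT_def intro: finite_subset[of \<alpha> "Pow N"])

section \<open>Iterated joins and products\<close>

text \<open>
  Folding is usually justified by commutativity of the operation on all arguments. This fails
  already for joins: joining \<open>{A}\<close> to a strictly increasing infinite chain above \<open>A\<close> loses \<open>A\<close>,
  because the chain has no maximal member, whereas \<open>A\<close> may survive if another set is joined first.
  Only the values on subsets of the index set matter, however: if some \<open>g\<close> tells the value there independently
  of the order of insertion, then every order of folding leads to the same result.
\<close>

lemma fold_eqI:
  assumes "finite A"
    and base: "z = g {}"
    and step: "\<And>x B. x \<in> A \<Longrightarrow> B \<subseteq> A \<Longrightarrow> x \<notin> B \<Longrightarrow> f x (g B) = g (insert x B)"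
  shows "Finite_Set.fold f z A = g A"
proof -
  have unique: "y = g B" if "fold_graph f z B y" "B \<subseteq> A" for B y
    using that by (induction rule: fold_graph.induct) (auto simp: base step)
  from finite_imp_fold_graph[OF assms(1)] obtain y where y: "fold_graph f z A y" ..
  have "fold_graph f z A (g A)"
    using y unique[OF y subset_refl] by simp
  then have "(THE y. fold_graph f z A y) = g A"
    by (rule the_equality) (rule unique[OF _ subset_refl])
  with assms(1) show ?thesis
    by (simp add: Finite_Set.fold_def)
qed

lemma max_sets_Un_max_sets:
  assumes "finite G"
  shows "max_sets (F \<union> max_sets G) = max_sets (F \<union> G)"
proof -
  have "down (F \<union> max_sets G) = down (F \<union> G)"
    using down_max_sets[OF assms] by (simp add: down_Un)
  then show ?thesis
    by (metis max_sets_down)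
qed

lemma amt_Join_eq:
  assumes "finite I" "I \<noteq> {}" "\<And>i. i \<in> I \<Longrightarrow> finite (\<kappa> i)"
  shows "amt_Join \<kappa> I = max_sets (\<Union>i\<in>I. \<kappa> i)"
proof -
  have "Finite_Set.fold (\<lambda>i \<beta>. \<kappa> i \<squnion> \<beta>) {} I = max_sets (\<Union>i\<in>I. \<kappa> i)"
  proof (rule fold_eqI[OF assms(1)])
    fix i J assume "J \<subseteq> I"
    then have "finite (\<Union>j\<in>J. \<kappa> j)"
      using assms(1,3) by (auto intro: finite_subset)
    then show "\<kappa> i \<squnion> max_sets (\<Union>j\<in>J. \<kappa> j) = max_sets (\<Union>j\<in>insert i J. \<kappa> j)"
      by (simp add: amt_join_def max_sets_Un_max_sets)
  qed (simp add: max_sets_def)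
  with assms(2) show ?thesis
    by (simp add: amt_Join_def)
qed

lemma down_amt_Join:
  assumes "finite I" "I \<noteq> {}" "\<And>i. i \<in> I \<Longrightarrow> finite (\<kappa> i)"
  shows "down (amt_Join \<kappa> I) = (\<Union>i\<in>I. down (\<kappa> i))"
  using assms by (simp add: amt_Join_eq down_max_sets down_UN)

text \<open>
  The generator formed from \<open>A\<close> and \<open>B\<close> is the largest set \<open>K\<close> inside the two spans with
  \<open>K \<inter> sp \<alpha> \<subseteq> A\<close> and \<open>K \<inter> sp \<beta> \<subseteq> B\<close>: a point outside one of the spans is constrained by the other factor only, and
  a point of both spans by both factors.
\<close>

lemma ext_prod_eq:
  "\<alpha> \<boxtimes> \<beta> = max_sets {K. K \<subseteq> sp \<alpha> \<union> sp \<beta> \<and> K \<inter> sp \<alpha> \<in> down \<alpha> \<and> K \<inter> sp \<beta> \<in> down \<beta>}"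
    (is "_ = max_sets ?Q")
proof -
  let ?G = "{(A - sp \<beta>) \<union> (B - sp \<alpha>) \<union> (A \<inter> B) | A B. A \<in> \<alpha> \<and> B \<in> \<beta>}"
  have mem_down_G: "K \<in> down ?G \<longleftrightarrow>
      (\<exists>A\<in>\<alpha>. \<exists>B\<in>\<beta>. K \<subseteq> (A - sp \<beta>) \<union> (B - sp \<alpha>) \<union> (A \<inter> B))" for K
    unfolding down_def by blast
  have mem_Q: "K \<in> ?Q \<longleftrightarrow>
      K \<subseteq> sp \<alpha> \<union> sp \<beta> \<and> (\<exists>A\<in>\<alpha>. \<exists>B\<in>\<beta>. K \<inter> sp \<alpha> \<subseteq> A \<and> K \<inter> sp \<beta> \<subseteq> B)" for K
    unfolding down_def by blast
  have "down ?G = ?Q"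
  proof
    show "down ?G \<subseteq> ?Q"
    proof
      fix K assume "K \<in> down ?G"
      then obtain A B where AB: "A \<in> \<alpha>" "B \<in> \<beta>"
        and K: "K \<subseteq> (A - sp \<beta>) \<union> (B - sp \<alpha>) \<union> (A \<inter> B)"
        unfolding mem_down_G by blast
      have "A \<subseteq> sp \<alpha>" "B \<subseteq> sp \<beta>"
        using AB by (auto simp: sp_def)
      with K have "K \<subseteq> sp \<alpha> \<union> sp \<beta>" "K \<inter> sp \<alpha> \<subseteq> A" "K \<inter> sp \<beta> \<subseteq> B"
        by blast+
      with AB show "K \<in> ?Q"
        unfolding mem_Q by blast
    qed
    show "?Q \<subseteq> down ?G"
    proof
      fix K assume "K \<in> ?Q"
      then obtain A B where AB: "A \<in> \<alpha>" "B \<in> \<beta>"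
        and K: "K \<subseteq> sp \<alpha> \<union> sp \<beta>" "K \<inter> sp \<alpha> \<subseteq> A" "K \<inter> sp \<beta> \<subseteq> B"
        unfolding mem_Q by blast
      have "K \<subseteq> (A - sp \<beta>) \<union> (B - sp \<alpha>) \<union> (A \<inter> B)"
        using K by blast
      with AB show "K \<in> down ?G"
        unfolding mem_down_G by blast
    qed
  qed
  moreover have "\<alpha> \<boxtimes> \<beta> = max_sets (down ?G)"
    by (simp only: ext_prod_def max_sets_down)
  ultimately show ?thesis
    by (simp only:)
qed

text \<open>
  The down-set of the iterated product, in a form that does not depend on the order of the factors:
  membership is tested on one span at a time.
\<close>

definition glued :: "('i \<Rightarrow> 'a set set) \<Rightarrow> 'i set \<Rightarrow> 'a set set" where
  "glued \<kappa> I = {K. K \<subseteq> (\<Union>i\<in>I. sp (\<kappa> i)) \<and> (\<forall>i\<in>I. K \<inter> sp (\<kappa> i) \<in> down (\<kappa> i))}"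

lemma glued_subset_closed: "X \<in> glued \<kappa> I \<Longrightarrow> Y \<subseteq> X \<Longrightarrow> Y \<in> glued \<kappa> I"
  unfolding glued_def by (auto intro: down_subset_closed)

lemma finite_glued:
  assumes "finite I" "\<And>i. i \<in> I \<Longrightarrow> finite (sp (\<kappa> i))"
  shows "finite (glued \<kappa> I)"
proof (rule finite_subset)
  show "glued \<kappa> I \<subseteq> Pow (\<Union>i\<in>I. sp (\<kappa> i))"
    by (auto simp: glued_def)
qed (use assms in simp)

lemma down_max_sets_glued:
  assumes "finite I" "\<And>i. i \<in> I \<Longrightarrow> finite (sp (\<kappa> i))"
  shows "down (max_sets (glued \<kappa> I)) = glued \<kappa> I"
  by (rule down_max_sets_closed[OF finite_glued[OF assms] glued_subset_closed])

text \<open>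
  Every point of a span \<open>sp (\<kappa> i)\<close> survives in the glued family: a singleton meets each other
  span in itself or in the empty set, and both are admissible because no \<open>\<kappa> j\<close> is empty.
\<close>

lemma sp_max_sets_glued:
  assumes "finite I" "\<And>i. i \<in> I \<Longrightarrow> finite (sp (\<kappa> i))" "\<And>i. i \<in> I \<Longrightarrow> \<kappa> i \<noteq> {}"
  shows "sp (max_sets (glued \<kappa> I)) = (\<Union>i\<in>I. sp (\<kappa> i))"
proof -
  have "{x} \<in> glued \<kappa> I \<longleftrightarrow> x \<in> (\<Union>i\<in>I. sp (\<kappa> i))" for x
  proof
    assume x: "x \<in> (\<Union>i\<in>I. sp (\<kappa> i))"
    have "{x} \<inter> sp (\<kappa> j) \<in> down (\<kappa> j)" if "j \<in> I" for j
      using assms(3)[OF that] empty_mem_down_iff[of "\<kappa> j"] singleton_mem_down_iff[of x "\<kappa> j"]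
      by (cases "x \<in> sp (\<kappa> j)") auto
    with x show "{x} \<in> glued \<kappa> I"
      by (simp add: glued_def)
  qed (simp add: glued_def)
  then show ?thesis
    using singleton_mem_down_iff[of _ "max_sets (glued \<kappa> I)"]
    by (simp add: down_max_sets_glued[OF assms(1,2)] set_eq_iff)
qed

text \<open>
  Multiplying by one more factor adds one local test. The tests already made are not disturbed,
  because the span of the partial product contains the spans of all its factors.
\<close>

lemma ext_Prod_eq:
  assumes "finite I" "\<And>i. i \<in> I \<Longrightarrow> finite (sp (\<kappa> i))" "\<And>i. i \<in> I \<Longrightarrow> \<kappa> i \<noteq> {}"
  shows "ext_Prod \<kappa> I = max_sets (glued \<kappa> I)"
  unfolding ext_Prod_def
proof (rule fold_eqI[OF assms(1)])
  show "{{}} = max_sets (glued \<kappa> {})"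
    by (auto simp: glued_def max_sets_def)
next
  fix i J assume iJ: "i \<in> I" "J \<subseteq> I"
  have J: "finite J" "\<And>j. j \<in> J \<Longrightarrow> finite (sp (\<kappa> j))" "\<And>j. j \<in> J \<Longrightarrow> \<kappa> j \<noteq> {}"
    using iJ assms by (auto intro: finite_subset)
  have restrict: "K \<inter> (\<Union>j\<in>J. sp (\<kappa> j)) \<inter> sp (\<kappa> j) = K \<inter> sp (\<kappa> j)" if "j \<in> J" for K j
    using that by blast
  have "{K. K \<subseteq> sp (\<kappa> i) \<union> (\<Union>j\<in>J. sp (\<kappa> j)) \<and> K \<inter> sp (\<kappa> i) \<in> down (\<kappa> i)
      \<and> K \<inter> (\<Union>j\<in>J. sp (\<kappa> j)) \<in> glued \<kappa> J} = glued \<kappa> (insert i J)"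
    unfolding glued_def using restrict by auto
  then show "\<kappa> i \<boxtimes> max_sets (glued \<kappa> J) = max_sets (glued \<kappa> (insert i J))"
    by (simp add: ext_prod_eq sp_max_sets_glued[OF J] down_max_sets_glued[OF J(1,2)])
qed

lemma down_ext_Prod:
  assumes "finite I" "\<And>i. i \<in> I \<Longrightarrow> finite (sp (\<kappa> i))" "\<And>i. i \<in> I \<Longrightarrow> \<kappa> i \<noteq> {}"
  shows "down (ext_Prod \<kappa> I) = glued \<kappa> I"
  using ext_Prod_eq[OF assms] down_max_sets_glued[OF assms(1,2)] by simp

section \<open>Antimonotonic functions with prescribed span\<close>

text \<open>
  For \<open>M \<noteq> {}\<close> the span condition already excludes the empty function; the separate condition
  \<open>\<kappa> \<noteq> {}\<close> matters for \<open>M = {}\<close>, where it leaves \<open>{{}}\<close> only.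
\<close>

lemma mem_Upsilon_iff:
  assumes "finite M"
  shows "\<kappa> \<in> Upsilon M \<longleftrightarrow> \<kappa> \<in> AMT M \<and> \<kappa> \<noteq> {} \<and> sp \<kappa> = M"
proof -
  have top: "\<kappa> \<preceq> amt_top M" if "\<kappa> \<in> AMT M"
    using that by (auto simp: AMT_def amt_le_def amt_top_def)
  have bot: "amt_bot M \<preceq> \<kappa> \<longleftrightarrow> \<kappa> \<noteq> {} \<and> M \<subseteq> sp \<kappa>"
  proof (cases "M = {}")
    case True
    then show ?thesis
      by (auto simp: amt_bot_def amt_Join_def amt_le_def)
  next
    case False
    have "max_sets (\<Union>x\<in>M. {{x}}) = (\<Union>x\<in>M. {{x}})"
      by (auto simp: max_sets_def)
    then have "amt_bot M = (\<Union>x\<in>M. {{x}})"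
      using amt_Join_eq[OF assms False, of "\<lambda>x. {{x}}"] by (simp add: amt_bot_def)
    then have "amt_bot M \<preceq> \<kappa> \<longleftrightarrow> M \<subseteq> sp \<kappa>"
      by (auto simp: amt_le_def sp_def)
    moreover have "\<kappa> \<noteq> {}" if "M \<subseteq> sp \<kappa>"
      using False that by (auto simp: sp_def)
    ultimately show ?thesis
      by blast
  qed
  have "sp \<kappa> \<subseteq> M" if "\<kappa> \<in> AMT M"
    using that by (auto simp: AMT_def sp_def)
  with top bot show ?thesis
    by (auto simp: Upsilon_def amt_interval_def)
qed

text \<open>The antimonotonic function that represents the part of the down-set of \<open>\<chi>\<close> lying inside \<open>S\<close>.\<close>

definition trace :: "'a set set \<Rightarrow> 'a set \<Rightarrow> 'a set set" where
  "trace \<chi> S = max_sets (down \<chi> \<inter> Pow S)"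

lemma down_trace: "finite S \<Longrightarrow> down (trace \<chi> S) = down \<chi> \<inter> Pow S"
  unfolding trace_def by (rule down_max_sets_closed) (auto intro: down_subset_closed)

lemma eq_trace_iff:
  assumes "finite S" "\<kappa> \<in> AMT S"
  shows "\<kappa> = trace \<chi> S \<longleftrightarrow> down \<kappa> = down \<chi> \<inter> Pow S"
  using down_trace[OF assms(1)] max_sets_down_AMT[OF assms(2)] by (metis trace_def)

lemma trace_Upsilon:
  assumes "finite N" "\<chi> \<in> Upsilon N" "S \<subseteq> N"
  shows "trace \<chi> S \<in> Upsilon S"
proof -
  have S: "finite S"
    using assms(1,3) finite_subset by blast
  have \<chi>: "\<chi> \<noteq> {}" "sp \<chi> = N"
    using assms(2) mem_Upsilon_iff[OF assms(1)] by auto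
  have "trace \<chi> S \<in> AMT S"
    unfolding trace_def by (rule max_sets_in_AMT) blast
  moreover have "trace \<chi> S \<noteq> {}"
    using \<chi>(1) by (simp add: empty_mem_down_iff[symmetric] down_trace[OF S])
  moreover have "sp (trace \<chi> S) = S"
    using \<chi>(2) assms(3)
    by (auto simp: singleton_mem_down_iff[symmetric] down_trace[OF S])
  ultimately show ?thesis
    using mem_Upsilon_iff[OF S] by blast
qed

section \<open>Intervals as fibres of the trace map\<close>

text \<open>
  The lower end gives \<open>down (\<kappa> S) \<subseteq> down \<chi>\<close>. The upper end, tested on a set \<open>X \<subseteq> S\<close>, for which
  \<open>X \<inter> S = X\<close>, gives the converse inclusion inside \<open>S\<close>. In the other direction, an equality of
  traces yields both bounds because \<open>down \<chi>\<close> contains \<open>K \<inter> S\<close> along with \<open>K\<close>.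
\<close>

lemma interval_eq_fibre:
  assumes "finite N" "sp \<sigma> = N" and \<kappa>: "\<And>S. S \<in> \<sigma> \<Longrightarrow> \<kappa> S \<in> Upsilon S"
  shows "amt_interval N (amt_Join \<kappa> \<sigma>) (ext_Prod \<kappa> \<sigma>)
    = {\<chi> \<in> Upsilon N. \<forall>S\<in>\<sigma>. \<kappa> S = trace \<chi> S}" (is "?I = ?F")
proof -
  have sub: "S \<subseteq> N" if "S \<in> \<sigma>" for S
    using that assms(2) by (auto simp: sp_def)
  have fin: "finite S" if "S \<in> \<sigma>" for S
    using sub[OF that] assms(1) finite_subset by blast
  have "finite \<sigma>"
    using sub assms(1) by (auto intro: finite_subset[of \<sigma> "Pow N"])
  have \<kappa>D: "\<kappa> S \<in> AMT S" "\<kappa> S \<noteq> {}" "sp (\<kappa> S) = S" if "S \<in> \<sigma>" for S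
    using \<kappa>[OF that] mem_Upsilon_iff[OF fin[OF that]] by auto
  have UN_sp: "(\<Union>S\<in>\<sigma>. sp (\<kappa> S)) = N"
    using \<kappa>D(3) assms(2) by (simp add: sp_def)
  have prod: "down (ext_Prod \<kappa> \<sigma>) = {K. K \<subseteq> N \<and> (\<forall>S\<in>\<sigma>. K \<inter> S \<in> down (\<kappa> S))}"
  proof -
    have "down (ext_Prod \<kappa> \<sigma>) = glued \<kappa> \<sigma>"
      by (rule down_ext_Prod[OF \<open>finite \<sigma>\<close>]) (auto simp: \<kappa>D fin)
    then show ?thesis
      using UN_sp \<kappa>D(3) by (simp add: glued_def)
  qed
  \<comment> \<open>The inserted \<open>{}\<close> changes the union only if \<open>\<sigma> = {}\<close>, where the join is \<open>{{}}\<close> by convention.\<close>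
  have join: "down (amt_Join \<kappa> \<sigma>) = insert {} (\<Union>S\<in>\<sigma>. down (\<kappa> S))"
  proof (cases "\<sigma> = {}")
    case True
    then show ?thesis
      by (simp add: amt_Join_def down_def)
  next
    case False
    have "down (amt_Join \<kappa> \<sigma>) = (\<Union>S\<in>\<sigma>. down (\<kappa> S))"
      by (rule down_amt_Join[OF \<open>finite \<sigma>\<close> False]) (use \<kappa>D(1) fin finite_AMT in blast)
    moreover have "{} \<in> (\<Union>S\<in>\<sigma>. down (\<kappa> S))"
      using False \<kappa>D(2) empty_mem_down_iff by blast
    ultimately show ?thesis
      by blast
  qed
  have "\<chi> \<in> ?I \<longleftrightarrow> \<chi> \<in> ?F" for \<chi>
  proof
    assume "\<chi> \<in> ?I"
    then have AMT: "\<chi> \<in> AMT N" and lower: "insert {} (\<Union>S\<in>\<sigma>. down (\<kappa> S)) \<subseteq> down \<chi>"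
      and upper: "down \<chi> \<subseteq> {K. K \<subseteq> N \<and> (\<forall>S\<in>\<sigma>. K \<inter> S \<in> down (\<kappa> S))}"
      by (auto simp: amt_interval_def amt_le_iff_down join prod)
    have "N \<subseteq> sp \<chi>"
    proof
      fix x assume "x \<in> N"
      then obtain S where S: "S \<in> \<sigma>" "x \<in> S"
        using assms(2) by (auto simp: sp_def)
      then have "{x} \<in> down (\<kappa> S)"
        using \<kappa>D(3) singleton_mem_down_iff by metis
      with S lower show "x \<in> sp \<chi>"
        using singleton_mem_down_iff[of x \<chi>] by blast
    qed
    moreover have "sp \<chi> \<subseteq> N"
      using AMT by (auto simp: AMT_def sp_def)
    moreover have "\<chi> \<noteq> {}"
      using lower empty_mem_down_iff[of \<chi>] by blast
    ultimately have "\<chi> \<in> Upsilon N"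
      using AMT mem_Upsilon_iff[OF assms(1)] by blast
    moreover have "\<kappa> S = trace \<chi> S" if S: "S \<in> \<sigma>" for S
    proof -
      have "X \<in> down (\<kappa> S)" if X: "X \<in> down \<chi>" "X \<subseteq> S" for X
      proof -
        have "X \<inter> S \<in> down (\<kappa> S)"
          using upper X(1) S by blast
        with X(2) show ?thesis
          by (simp add: Int_absorb2)
      qed
      moreover have "down (\<kappa> S) \<subseteq> Pow S"
        using down_subset_Pow_sp[of "\<kappa> S"] \<kappa>D(3)[OF S] by simp
      ultimately have "down (\<kappa> S) = down \<chi> \<inter> Pow S"
        using lower S by blast
      then show ?thesis
        using eq_trace_iff[OF fin[OF S] \<kappa>D(1)[OF S]] by blast
    qed
    ultimately show "\<chi> \<in> ?F"
      by blast
  next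
    assume "\<chi> \<in> ?F"
    then have \<chi>: "\<chi> \<in> AMT N" "\<chi> \<noteq> {}" "sp \<chi> = N"
      and \<kappa>_eq: "\<And>S. S \<in> \<sigma> \<Longrightarrow> \<kappa> S = trace \<chi> S"
      using mem_Upsilon_iff[OF assms(1)] by auto
    have trace: "down (\<kappa> S) = down \<chi> \<inter> Pow S" if "S \<in> \<sigma>" for S
      using \<kappa>_eq[OF that] down_trace[OF fin[OF that]] by simp
    have "insert {} (\<Union>S\<in>\<sigma>. down (\<kappa> S)) \<subseteq> down \<chi>"
      using trace \<chi>(2) empty_mem_down_iff[of \<chi>] by blast
    moreover have "down \<chi> \<subseteq> {K. K \<subseteq> N \<and> (\<forall>S\<in>\<sigma>. K \<inter> S \<in> down (\<kappa> S))}"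
      using trace down_subset_Pow_sp[of \<chi>] \<chi>(3) down_subset_closed[OF _ Int_lower1] by auto
    ultimately show "\<chi> \<in> ?I"
      using \<chi>(1) by (simp add: amt_interval_def amt_le_iff_down join prod)
  qed
  then show ?thesis
    by blast
qed

theorem theorem2:
  fixes N :: "nat set" and \<sigma> :: "nat set set"
  assumes "finite N" and "\<forall>n\<in>N. 0 < n"
    and "\<sigma> \<in> AMT N" and "sp \<sigma> = N"
  shows "partition_on (Upsilon N)
    {I. \<exists>\<kappa>. (\<forall>S\<in>\<sigma>. \<kappa> S \<in> Upsilon S) \<and>
         I = amt_interval N (amt_Join \<kappa> \<sigma>) (ext_Prod \<kappa> \<sigma>) \<and> I \<noteq> {}}"
    (is "partition_on _ ?P")
proof (rule partition_onI)
  have fibre: "\<exists>\<kappa>. (\<forall>S\<in>\<sigma>. \<kappa> S \<in> Upsilon S)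
      \<and> I = {\<chi> \<in> Upsilon N. \<forall>S\<in>\<sigma>. \<kappa> S = trace \<chi> S} \<and> I \<noteq> {}" if mem: "I \<in> ?P" for I
  proof -
    obtain \<kappa> where \<kappa>: "\<forall>S\<in>\<sigma>. \<kappa> S \<in> Upsilon S"
      and I: "I = amt_interval N (amt_Join \<kappa> \<sigma>) (ext_Prod \<kappa> \<sigma>)" "I \<noteq> {}"
      using mem by blast
    have "I = {\<chi> \<in> Upsilon N. \<forall>S\<in>\<sigma>. \<kappa> S = trace \<chi> S}"
      unfolding I(1) using \<kappa> by (intro interval_eq_fibre[OF assms(1,4)]) blast
    with \<kappa> I(2) show ?thesis
      by blast
  qed
  show "\<Union>?P = Upsilon N"
  proof
    show "\<Union>?P \<subseteq> Upsilon N"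
      using fibre by blast
    show "Upsilon N \<subseteq> \<Union>?P"
    proof
      fix \<chi> assume \<chi>: "\<chi> \<in> Upsilon N"
      have traces: "trace \<chi> S \<in> Upsilon S" if "S \<in> \<sigma>" for S
        using that assms(4) by (intro trace_Upsilon[OF assms(1) \<chi>]) (auto simp: sp_def)
      have "\<chi> \<in> amt_interval N (amt_Join (trace \<chi>) \<sigma>) (ext_Prod (trace \<chi>) \<sigma>)"
        using interval_eq_fibre[OF assms(1,4) traces] \<chi> by simp
      with traces show "\<chi> \<in> \<Union>?P"
        by blast
    qed
  qed
  show "disjnt I J" if IJ: "I \<in> ?P" "J \<in> ?P" "I \<noteq> J" for I J
  proof -
    obtain \<kappa> \<mu> where I: "I = {\<chi> \<in> Upsilon N. \<forall>S\<in>\<sigma>. \<kappa> S = trace \<chi> S}"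
      and J: "J = {\<chi> \<in> Upsilon N. \<forall>S\<in>\<sigma>. \<mu> S = trace \<chi> S}"
      using fibre[OF IJ(1)] fibre[OF IJ(2)] by blast
    have "I = J" if "\<chi> \<in> I" "\<chi> \<in> J" for \<chi>
      using that unfolding I J by auto
    with \<open>I \<noteq> J\<close> show ?thesis
      by (auto simp: disjnt_def)
  qed
  show "{} \<notin> ?P"
    by blast
qed

end
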